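(* Let $\beta,\beta'$ be two observers in Minkowski spacetime with 4-velocities $U,U'$ respectively. Let $S_{\mathrm{obs}}$ be the relative position of $\beta'$ observed by $\beta$, and let $V_{\mathrm{ast}}$ be the astrometric relative velocity of $\beta'$ observed by $\beta$. Then, at every event $p$ of $\beta$, $$V_{\mathrm{ast}}=\frac{1}{g\left(U',\frac{S_{\mathrm{obs}}}{\|S_{\mathrm{obs}}\|}-U\right)}\bigl(U'+g(U',U)\,U\bigr)+\|S_{\mathrm{obs}}\|\,\nabla_U U,$$ where $V_{\mathrm{ast}}$, $U$, $S_{\mathrm{obs}}$, $\nabla_U U$ are evaluated at $p$, and $U'$ is evaluated at $q$, the unique event of $\beta'\cap E_p^-$ (vectors at $q$ and at $p$ being identified by the affine structure of Minkowski spacetime).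
   Context: Minkowski spacetime is the 4-dimensional affine space with flat metric $g$ of signature $(-,+,+,+)$, $c=1$, with a fixed time orientation; $\nabla$ is the Levi-Civita connection (so, for a vector field $X$ along $\beta$ with $\beta$ parameterized by proper time $\tau$, $\nabla_U X=\frac{dX}{d\tau}$). For events $p,q$, $q-p$ denotes the vector joining $p$ to $q$. For a spacelike vector $x$, $\|x\|=\sqrt{g(x,x)}$. An observer is a (smooth) future-directed timelike curve $\beta:I\to\mathcal M$, with $I\subset\mathbb R$ an interval, parameterized by proper time and identified with its image; its 4-velocity $U$ is its tangent field, which satisfies $g(U,U)=-1$. For an event $p$, $E_p^-$ is the set of events $q\neq p$ such that $q-p$ is a past-pointing lightlike vector. Observed relative position: it is assumed that for every $p\in\beta$ there is a unique event $q$ of $\beta'\cap E_p^-$. The relative position of $\beta'$ observed by $\beta$ is the vector field $S_{\mathrm{obs}}$ along $\beta$ given by the projection of $q-p$ onto $U_p^\perp$: $S_{\mathrm{obs}\,p}=(q-p)+g(q-p,U_p)\,U_p$. Astrometric relative velocity of $\beta'$ observed by $\beta$: the vector field along $\beta$ $V_{\mathrm{ast}}:=\nabla_U S_{\mathrm{obs}}+g(\nabla_U S_{\mathrm{obs}},U)\,U$. *)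

theory Defs
  imports "HOL-Analysis.Analysis"
begin

(* Minkowski spacetime in an inertial frame (c = 1): time component first, then the
   spatial components. Events and vectors share this type, through the choice of an
   origin of the affine space; this also identifies the tangent spaces at all events. *)
type_synonym spacetime = "real \<times> (real ^ 3)"

definition mink :: "spacetime \<Rightarrow> spacetime \<Rightarrow> real" where
  "mink x y = - (fst x * fst y) + snd x \<bullet> snd y"

(* Intended for spacelike vectors. *)
definition mink_norm :: "spacetime \<Rightarrow> real" where
  "mink_norm x = sqrt (mink x x)"

definition timelike :: "spacetime \<Rightarrow> bool" where
  "timelike x \<longleftrightarrow> mink x x < 0"

definition lightlike :: "spacetime \<Rightarrow> bool" where
  "lightlike x \<longleftrightarrow> x \<noteq> 0 \<and> mink x x = 0"

(* The time orientation is the one in which the time coordinate increases; the two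
   predicates below are meant for causal (timelike or lightlike) vectors. *)
definition future_pointing :: "spacetime \<Rightarrow> bool" where
  "future_pointing x \<longleftrightarrow> 0 < fst x"

definition past_pointing :: "spacetime \<Rightarrow> bool" where
  "past_pointing x \<longleftrightarrow> fst x < 0"

(* All derivatives are taken within the interval I, so that they are one-sided at
   those endpoints that belong to I. *)
definition smooth_curve_on :: "real set \<Rightarrow> (real \<Rightarrow> spacetime) \<Rightarrow> bool" where
  "smooth_curve_on I f \<longleftrightarrow>
     (\<exists>D :: nat \<Rightarrow> real \<Rightarrow> spacetime.
        (\<forall>t\<in>I. D 0 t = f t) \<and>
        (\<forall>n. \<forall>t\<in>I. (D n has_vector_derivative D (Suc n) t) (at t within I)))"

(* Vector fields along a curve are functions of its parameter. *)
definition four_velocity :: "(real \<Rightarrow> spacetime) \<Rightarrow> real set \<Rightarrow> real \<Rightarrow> spacetime" where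
  "four_velocity \<beta> I t = vector_derivative \<beta> (at t within I)"

(* The normalization mink U U = -1 says that the parameter is proper time. Two distinct
   parameters are required so that the interval is nondegenerate and the tangent
   field is well defined. *)
definition observer :: "(real \<Rightarrow> spacetime) \<Rightarrow> real set \<Rightarrow> bool" where
  "observer \<beta> I \<longleftrightarrow>
     is_interval I \<and> (\<exists>a\<in>I. \<exists>b\<in>I. a < b) \<and>
     smooth_curve_on I \<beta> \<and>
     (\<forall>t\<in>I. timelike (four_velocity \<beta> I t) \<and>
            future_pointing (four_velocity \<beta> I t) \<and>
            mink (four_velocity \<beta> I t) (four_velocity \<beta> I t) = -1)"

(* The covariant derivative along the observer of a vector field X along it: the
   connection is flat and the parameter is proper time. *)
definition nabla_U :: "real set \<Rightarrow> (real \<Rightarrow> spacetime) \<Rightarrow> real \<Rightarrow> spacetime" where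
  "nabla_U I X t = vector_derivative X (at t within I)"

(* Projection onto the orthogonal complement of u, for mink u u = -1. *)
definition proj_orth :: "spacetime \<Rightarrow> spacetime \<Rightarrow> spacetime" where
  "proj_orth u x = x + mink x u *\<^sub>R u"

definition E_minus :: "spacetime \<Rightarrow> spacetime set" where
  "E_minus p = {q. q \<noteq> p \<and> lightlike (q - p) \<and> past_pointing (q - p)}"

(* Meaningful only if the event q exists and is unique. *)
definition observed_event ::
    "(real \<Rightarrow> spacetime) \<Rightarrow> real set \<Rightarrow> spacetime \<Rightarrow> spacetime" where
  "observed_event \<beta>' I' p = (THE q. q \<in> \<beta>' ` I' \<inter> E_minus p)"

definition S_obs ::
    "(real \<Rightarrow> spacetime) \<Rightarrow> real set \<Rightarrow> (real \<Rightarrow> spacetime) \<Rightarrow> real set \<Rightarrow> real \<Rightarrow> spacetime" where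
  "S_obs \<beta> I \<beta>' I' t =
     proj_orth (four_velocity \<beta> I t) (observed_event \<beta>' I' (\<beta> t) - \<beta> t)"

definition V_ast ::
    "(real \<Rightarrow> spacetime) \<Rightarrow> real set \<Rightarrow> (real \<Rightarrow> spacetime) \<Rightarrow> real set \<Rightarrow> real \<Rightarrow> spacetime" where
  "V_ast \<beta> I \<beta>' I' t =
     proj_orth (four_velocity \<beta> I t) (nabla_U I (S_obs \<beta> I \<beta>' I') t)"

end

theory Submission
  imports Defs
begin

text \<open>
  Let \<open>\<sigma>\<close> send a parameter of \<open>\<beta>\<close> to the parameter of the event of \<open>\<beta>'\<close> observed there, and put
  \<open>L = \<beta>' \<circ> \<sigma> - \<beta>\<close>. Differentiating \<open>g(L, L) = 0\<close> gives \<open>\<sigma>' = g(U, L) / g(U', L)\<close>. Since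
  \<open>\<parallel>S\<parallel> = g(L, U)\<close> and \<open>L = S - \<parallel>S\<parallel> U\<close>, this is the coefficient of the statement; the product rule
  for \<open>S = L + g(L, U) U\<close> and projection onto the complement of \<open>U\<close>, which is orthogonal to the
  acceleration, give the formula.
  That \<open>\<sigma>\<close> is differentiable at all, also at endpoints, comes from its continuity: it is a root
  of the advanced time of \<open>\<beta>'\<close> relative to \<open>\<beta>\<close>, which is strictly increasing along \<open>\<beta>'\<close>.
\<close>

section \<open>Algebra and signs of the Minkowski form\<close>

lemma bounded_bilinear_mink: "bounded_bilinear mink"
proof -
  have 1: "bounded_bilinear (\<lambda>(x::spacetime) (y::spacetime). fst x * fst y)"
    by (rule bounded_bilinear.comp[OF bounded_bilinear_mult bounded_linear_fst bounded_linear_fst])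
  have 2: "bounded_bilinear (\<lambda>(x::spacetime) (y::spacetime). snd x \<bullet> snd y)"
    by (rule bounded_bilinear.comp[OF bounded_bilinear_inner bounded_linear_snd bounded_linear_snd])
  interpret a: bounded_bilinear "\<lambda>(x::spacetime) (y::spacetime). fst x * fst y" by (rule 1)
  interpret b: bounded_bilinear "\<lambda>(x::spacetime) (y::spacetime). snd x \<bullet> snd y" by (rule 2)
  obtain K where K: "\<And>(x::spacetime) (y::spacetime). norm (fst x * fst y) \<le> norm x * norm y * K"
    using a.bounded by blast
  obtain M where M: "\<And>(x::spacetime) (y::spacetime). norm (snd x \<bullet> snd y) \<le> norm x * norm y * M"
    using b.bounded by blast
  show ?thesis
  proof
    show "\<exists>K. \<forall>x y. norm (mink x y) \<le> norm x * norm y * K"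
    proof (intro exI allI)
      fix x y :: spacetime
      show "norm (mink x y) \<le> norm x * norm y * (K + M)"
        using K[of x y] M[of x y] unfolding mink_def distrib_left by simp
    qed
  qed (simp_all add: mink_def algebra_simps)
qed

lemmas mink_linear_simps =
  bounded_bilinear.add_left[OF bounded_bilinear_mink]
  bounded_bilinear.add_right[OF bounded_bilinear_mink]
  bounded_bilinear.diff_left[OF bounded_bilinear_mink]
  bounded_bilinear.diff_right[OF bounded_bilinear_mink]
  bounded_bilinear.scaleR_left[OF bounded_bilinear_mink]
  bounded_bilinear.scaleR_right[OF bounded_bilinear_mink]

lemma mink_commute: "mink x y = mink y x"
  by (simp add: mink_def inner_commute)

lemma norm_snd_less_fst:
  assumes "timelike u" "future_pointing u"
  shows "norm (snd u) < fst u"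
proof -
  have "(norm (snd u))\<^sup>2 < (fst u)\<^sup>2"
    using assms(1) by (simp add: timelike_def mink_def power2_norm_eq_inner) (simp add: power2_eq_square)
  then show ?thesis
    using assms(2) by (auto simp: future_pointing_def intro: power2_less_imp_less)
qed

lemma norm_snd_eq_fst:
  assumes "lightlike x" "past_pointing x"
  shows "norm (snd x) = - fst x"
proof -
  have "(norm (snd x))\<^sup>2 = (- fst x)\<^sup>2"
    using assms(1) by (simp add: lightlike_def mink_def power2_norm_eq_inner) (simp add: power2_eq_square)
  then show ?thesis
    using assms(2) norm_ge_zero[of "snd x"] unfolding past_pointing_def power2_eq_iff by linarith
qed

text \<open>The time term of the form is \<open>fst u\<close> times the spatial length of
  \<open>x\<close>; it beats the spatial inner product by Cauchy-Schwarz, strictly because that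
  length is nonzero. This keeps the later denominators nonzero and fixes the sign of the root in the
  norm of the relative position.\<close>

lemma mink_future_past_pos:
  assumes "timelike u" "future_pointing u" "lightlike x" "past_pointing x"
  shows "0 < mink u x"
proof -
  have n: "norm (snd x) = - fst x" using assms(3,4) by (rule norm_snd_eq_fst)
  have "norm (snd u) * norm (snd x) < fst u * norm (snd x)"
    using norm_snd_less_fst[OF assms(1,2)] n assms(4)
    by (intro mult_strict_right_mono) (auto simp: past_pointing_def)
  moreover have "- (norm (snd u) * norm (snd x)) \<le> snd u \<bullet> snd x"
    using Cauchy_Schwarz_ineq2[of "snd u" "snd x"] by linarith
  ultimately show ?thesis by (simp add: mink_def n)
qed

text \<open>The cross term contributes twice the square of \<open>mink x u\<close> and the
  \<open>u\<close> term subtracts it once; the sign hypothesis selects the root.\<close>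

lemma mink_norm_proj_orth:
  assumes "mink x x = 0" "mink u u = -1" "0 \<le> mink x u"
  shows "mink_norm (proj_orth u x) = mink x u"
proof -
  have "mink (proj_orth u x) (proj_orth u x) = (mink x u)\<^sup>2"
    using assms(1,2)
    by (simp add: proj_orth_def mink_linear_simps mink_commute[of u x] power2_eq_square)
  then show ?thesis
    using assms(3) by (simp add: mink_norm_def)
qed

section \<open>Calculus along an observer\<close>

lemma interval_at_within_nontrivial:
  fixes I :: "real set"
  assumes "is_interval I" "a \<in> I" "b \<in> I" "a < b" "t \<in> I"
  shows "at t within I \<noteq> bot"
proof -
  have "\<exists>x. I \<noteq> {x}" using assms by (metis less_irrefl singletonD)
  moreover have "I \<noteq> {t}" using assms by auto
  ultimately have "t islimpt I"
    using assms by (intro connected_imp_perfect) (auto simp: is_interval_connected)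
  then show ?thesis by (simp add: trivial_limit_within)
qed

text \<open>Derivatives within \<open>I\<close> are unique, endpoints included, only because this
  filter is not trivial; every evaluation of \<open>vector_derivative\<close> relies on it.\<close>

lemma observer_at_within_nontrivial:
  assumes "observer \<beta> I" "t \<in> I"
  shows "at t within I \<noteq> bot"
  using assms interval_at_within_nontrivial unfolding observer_def by metis

text \<open>Smoothness only provides some sequence \<open>D\<close> of successive derivatives;
  uniqueness identifies \<open>D 1\<close> with the 4-velocity and \<open>D 2\<close> with the
  acceleration.\<close>

lemma observer_has_vector_derivative:
  assumes "observer \<beta> I" "t \<in> I"
  shows "(\<beta> has_vector_derivative four_velocity \<beta> I t) (at t within I)"
    and "(four_velocity \<beta> I has_vector_derivative nabla_U I (four_velocity \<beta> I) t) (at t within I)"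
proof -
  obtain D where D0: "\<And>t. t \<in> I \<Longrightarrow> D 0 t = \<beta> t"
    and D: "\<And>n t. t \<in> I \<Longrightarrow> (D n has_vector_derivative D (Suc n) t) (at t within I)"
    using assms(1) unfolding observer_def smooth_curve_on_def by metis
  have d\<beta>: "(\<beta> has_vector_derivative D 1 r) (at r within I)" if "r \<in> I" for r
    using has_vector_derivative_transform[OF that _ D[OF that, of 0], of \<beta>] D0 by simp
  have U: "four_velocity \<beta> I r = D 1 r" if "r \<in> I" for r
    unfolding four_velocity_def
    using observer_at_within_nontrivial[OF assms(1) that] d\<beta>[OF that]
    by (rule vector_derivative_within)
  show "(\<beta> has_vector_derivative four_velocity \<beta> I t) (at t within I)"
    using d\<beta> U assms(2) by simp
  have dU: "(four_velocity \<beta> I has_vector_derivative D 2 t) (at t within I)"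
    using has_vector_derivative_transform[OF assms(2) _ D[OF assms(2), of 1], of "four_velocity \<beta> I"] U
    by (simp add: numeral_2_eq_2)
  then have "nabla_U I (four_velocity \<beta> I) t = D 2 t"
    unfolding nabla_U_def
    by (rule vector_derivative_within[OF observer_at_within_nontrivial[OF assms]])
  with dU show "(four_velocity \<beta> I has_vector_derivative nabla_U I (four_velocity \<beta> I) t) (at t within I)"
    by simp
qed

lemma observer_four_velocity:
  assumes "observer \<beta> I" "t \<in> I"
  shows "timelike (four_velocity \<beta> I t)" "future_pointing (four_velocity \<beta> I t)"
    "mink (four_velocity \<beta> I t) (four_velocity \<beta> I t) = -1"
  using assms by (auto simp: observer_def)

lemma acceleration_orthogonal:
  assumes "observer \<beta> I" "t \<in> I"
  shows "mink (nabla_U I (four_velocity \<beta> I) t) (four_velocity \<beta> I t) = 0"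
proof -
  let ?U = "four_velocity \<beta> I" and ?a = "nabla_U I (four_velocity \<beta> I) t"
  note dU = observer_has_vector_derivative(2)[OF assms]
  have "((\<lambda>r. mink (?U r) (?U r)) has_vector_derivative mink (?U t) ?a + mink ?a (?U t)) (at t within I)"
    by (rule bounded_bilinear.has_vector_derivative[OF bounded_bilinear_mink dU dU])
  moreover have "((\<lambda>r. mink (?U r) (?U r)) has_vector_derivative 0) (at t within I)"
    using has_vector_derivative_const
    by (rule has_vector_derivative_transform[OF assms(2), rotated])
      (rule observer_four_velocity(3)[OF assms(1)])
  ultimately have "mink (?U t) ?a + mink ?a (?U t) = 0"
    using observer_at_within_nontrivial[OF assms] vector_derivative_unique_within by blast
  then show ?thesis by (simp add: mink_commute)
qed

section \<open>Advanced time along an observer\<close>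

lemma observer_chronological:
  assumes "observer \<beta> I" "a \<in> I" "b \<in> I" "a < b"
  shows "norm (snd (\<beta> b - \<beta> a)) < fst (\<beta> b - \<beta> a)"
proof -
  \<comment> \<open>The mean value theorem with equality needs a scalar function, so the curve is
    tested against the direction \<open>n\<close> of its own spatial displacement. If that
    displacement vanishes then \<open>n = 0\<close>, which is why only \<open>norm n \<le> 1\<close>
    is used.\<close>
  define n where "n = sgn (snd (\<beta> b - \<beta> a))"
  define f where "f x = fst x - n \<bullet> snd x" for x :: spacetime
  let ?U = "four_velocity \<beta> I"
  have "is_interval I" using assms(1) by (simp add: observer_def)
  then have sub: "{a..b} \<subseteq> I"
    using assms(2,3) unfolding is_interval_1 by (meson atLeastAtMost_iff subsetI)
  have f: "bounded_linear f"
    unfolding f_def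
    by (intro bounded_linear_sub bounded_linear_fst
        bounded_linear_compose[OF bounded_linear_inner_right bounded_linear_snd])
  have df: "((\<lambda>r. f (\<beta> r)) has_vector_derivative f (?U r)) (at r within {a..b})" if "r \<in> {a..b}" for r
  proof -
    have "(\<beta> has_vector_derivative ?U r) (at r within {a..b})"
      using observer_has_vector_derivative(1)[OF assms(1)] sub that
      by (blast intro: has_vector_derivative_within_subset)
    then show ?thesis
      by (rule bounded_linear.has_vector_derivative[OF f])
  qed
  have pos: "0 < f (?U r)" if "r \<in> {a..b}" for r
  proof -
    have "norm n \<le> 1" by (simp add: n_def norm_sgn)
    then have "n \<bullet> snd (?U r) \<le> norm (snd (?U r))"
      using norm_cauchy_schwarz[of n "snd (?U r)"] mult_right_mono[of "norm n" 1 "norm (snd (?U r))"]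
      by simp
    moreover have "norm (snd (?U r)) < fst (?U r)"
      using norm_snd_less_fst observer_four_velocity[OF assms(1)] sub that by blast
    ultimately show ?thesis by (simp add: f_def)
  qed
  have "\<exists>r\<in>{a<..<b}. f (\<beta> b) - f (\<beta> a) = (b - a) *\<^sub>R f (?U r)"
    using mvt_simple[OF assms(4), of "\<lambda>r. f (\<beta> r)" "\<lambda>r h. h *\<^sub>R f (?U r)"] df
    by (auto simp: has_vector_derivative_def)
  then obtain r where "r \<in> {a<..<b}" "f (\<beta> b) - f (\<beta> a) = (b - a) * f (?U r)" by auto
  then have "0 < f (\<beta> b) - f (\<beta> a)"
    using pos[of r] assms(4) by simp
  also have "\<dots> = f (\<beta> b - \<beta> a)"
    by (simp add: bounded_linear.linear[OF f] linear_diff)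
  finally have "n \<bullet> snd (\<beta> b - \<beta> a) < fst (\<beta> b - \<beta> a)" by (simp add: f_def)
  moreover have "n \<bullet> snd (\<beta> b - \<beta> a) = norm (snd (\<beta> b - \<beta> a))"
    unfolding n_def sgn_div_norm
    by (cases "snd (\<beta> b - \<beta> a) = 0") (simp_all add: dot_square_norm power2_eq_square del: snd_diff)
  ultimately show ?thesis by simp
qed

text \<open>The null coordinate t + r about the origin. It vanishes exactly on the past light cone,
  apex included, so observation from \<open>p\<close> becomes a scalar equation in
  \<open>x - p\<close>.\<close>

definition advanced_time :: "spacetime \<Rightarrow> real" where
  "advanced_time x = fst x + norm (snd x)"

lemma advanced_time_E_minus:
  "q \<in> E_minus p \<Longrightarrow> advanced_time (q - p) = 0"
  using norm_snd_eq_fst[of "q - p"] by (simp add: E_minus_def advanced_time_def)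

text \<open>By the triangle inequality the distance to \<open>p\<close> falls by at most the spatial
  displacement, which is less than the time elapsed.\<close>

lemma advanced_time_strict_mono:
  assumes "observer \<beta> I" "a \<in> I" "b \<in> I" "a < b"
  shows "advanced_time (\<beta> a - p) < advanced_time (\<beta> b - p)"
proof -
  have "norm (snd (\<beta> a - p)) \<le> norm (snd (\<beta> b - p)) + norm (snd (\<beta> b - \<beta> a))"
    using norm_triangle_ineq4[of "snd (\<beta> b - p)" "snd (\<beta> b - \<beta> a)"] by simp
  with observer_chronological[OF assms] show ?thesis
    by (simp add: advanced_time_def)
qed

lemma advanced_time_inj:
  assumes "observer \<beta> I" "a \<in> I" "b \<in> I" "\<beta> a \<in> E_minus p" "\<beta> b \<in> E_minus p"
  shows "a = b"
  using advanced_time_strict_mono[OF assms(1), of a b p] advanced_time_strict_mono[OF assms(1), of b a p]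
    assms advanced_time_E_minus by (metis less_irrefl linorder_neqE)

text \<open>For a fixed parameter \<open>c\<close>, the sign of the advanced time of
  \<open>\<beta>' c\<close> relative to \<open>\<beta> r\<close> persists for \<open>r\<close> near
  \<open>t\<close>; strict monotonicity along \<open>\<beta>'\<close> turns this sign into the side
  of \<open>c\<close> on which the root \<open>\<sigma> r\<close> lies.\<close>

lemma observed_parameter_continuous:
  assumes obs': "observer \<beta>' I'"
    and cont: "continuous (at t within I) \<beta>"
    and t: "t \<in> I"
    and \<sigma>: "\<And>r. r \<in> I \<Longrightarrow> \<sigma> r \<in> I' \<and> \<beta>' (\<sigma> r) \<in> E_minus (\<beta> r)"
  shows "continuous (at t within I) \<sigma>"
  unfolding continuous_within
proof (rule order_tendstoI)
  have int: "is_interval I'" using obs' by (simp add: observer_def)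
  have h0: "advanced_time (\<beta>' (\<sigma> r) - \<beta> r) = 0" if "r \<in> I" for r
    using \<sigma> that advanced_time_E_minus by blast
  have lim: "((\<lambda>r. advanced_time (\<beta>' c - \<beta> r)) \<longlongrightarrow> advanced_time (\<beta>' c - \<beta> t)) (at t within I)" for c
    using cont unfolding continuous_within advanced_time_def by (intro tendsto_intros)
  have I: "\<forall>\<^sub>F r in at t within I. r \<in> I"
    by (simp add: eventually_at_filter)
  fix c
  {
    assume c: "\<sigma> t < c"
    show "\<forall>\<^sub>F r in at t within I. \<sigma> r < c"
    proof (cases "c \<in> I'")
      \<comment> \<open>If some \<open>\<sigma> r\<close> were on the other side of
        \<open>c\<close>, then \<open>c\<close> would lie between two points of the interval
        \<open>I'\<close>.\<close>
      case False
      then have "\<sigma> r < c" if "r \<in> I" for r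
        using int \<sigma>[OF that] \<sigma>[OF t] c unfolding is_interval_1 by (meson less_imp_le not_less)
      then show ?thesis using I by (auto elim: eventually_mono)
    next
      case True
      then have "0 < advanced_time (\<beta>' c - \<beta> t)"
        using advanced_time_strict_mono[OF obs' _ True c, of "\<beta> t"] \<sigma>[OF t] h0[OF t] by simp
      then have "\<forall>\<^sub>F r in at t within I. 0 < advanced_time (\<beta>' c - \<beta> r)"
        by (rule order_tendstoD(1)[OF lim])
      then show ?thesis using I
      proof eventually_elim
        case (elim r)
        then show ?case
          using advanced_time_strict_mono[OF obs' True, of "\<sigma> r" "\<beta> r"] \<sigma>[of r] h0[of r]
          by (metis linorder_neqE less_asym less_irrefl)
      qed
    qed
  next
    assume c: "c < \<sigma> t"
    show "\<forall>\<^sub>F r in at t within I. c < \<sigma> r"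
    proof (cases "c \<in> I'")
      case False
      then have "c < \<sigma> r" if "r \<in> I" for r
        using int \<sigma>[OF that] \<sigma>[OF t] c unfolding is_interval_1 by (meson less_imp_le not_less)
      then show ?thesis using I by (auto elim: eventually_mono)
    next
      case True
      then have "advanced_time (\<beta>' c - \<beta> t) < 0"
        using advanced_time_strict_mono[OF obs' True _ c, of "\<beta> t"] \<sigma>[OF t] h0[OF t] by simp
      then have "\<forall>\<^sub>F r in at t within I. advanced_time (\<beta>' c - \<beta> r) < 0"
        by (rule order_tendstoD(2)[OF lim])
      then show ?thesis using I
      proof eventually_elim
        case (elim r)
        then show ?case
          using advanced_time_strict_mono[OF obs' _ True, of "\<sigma> r" "\<beta> r"] \<sigma>[of r] h0[of r]
          by (metis linorder_neqE less_asym less_irrefl)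
      qed
    qed
  }
qed

section \<open>Differentiability of the observed parameter\<close>

text \<open>Caratheodory's form of differentiability, which survives composition with a map that is
  only known to be continuous.\<close>
lemma has_vector_derivative_slope:
  fixes f :: "real \<Rightarrow> 'a::real_normed_vector"
  assumes "(f has_vector_derivative d) (at x within S)"
  obtains A where "\<And>y. f y - f x = (y - x) *\<^sub>R A y" "continuous (at x within S) A" "A x = d"
proof
  define A where "A y = (if y = x then d else (f y - f x) /\<^sub>R (y - x))" for y
  show "f y - f x = (y - x) *\<^sub>R A y" for y by (simp add: A_def)
  show "A x = d" by (simp add: A_def)
  have "((\<lambda>y. (1 / norm (y - x)) *\<^sub>R (f y - (f x + (y - x) *\<^sub>R d))) \<longlongrightarrow> 0) (at x within S)"
    using assms by (simp add: has_vector_derivative_def has_derivative_within)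
  then have "((\<lambda>y. norm ((1 / norm (y - x)) *\<^sub>R (f y - (f x + (y - x) *\<^sub>R d)))) \<longlongrightarrow> 0) (at x within S)"
    by (rule tendsto_norm_zero)
  \<comment> \<open>The remainder in the derivative is divided by \<open>norm (y - x)\<close>, the
    slope by \<open>y - x\<close>; they differ by a sign, so only norms are compared.\<close>
  moreover have "\<forall>\<^sub>F y in at x within S.
      norm ((1 / norm (y - x)) *\<^sub>R (f y - (f x + (y - x) *\<^sub>R d))) = norm (A y - d)"
    unfolding eventually_at_filter
  proof (intro always_eventually allI impI)
    fix y assume "y \<noteq> x"
    then have "A y - d = (1 / (y - x)) *\<^sub>R (f y - (f x + (y - x) *\<^sub>R d))"
      by (simp add: A_def divide_inverse scaleR_diff_right scaleR_add_right)
    then show "norm ((1 / norm (y - x)) *\<^sub>R (f y - (f x + (y - x) *\<^sub>R d))) = norm (A y - d)"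
      by simp
  qed
  ultimately have "((\<lambda>y. norm (A y - d)) \<longlongrightarrow> 0) (at x within S)"
    by (rule Lim_transform_eventually)
  then show "continuous (at x within S) A"
    unfolding continuous_within \<open>A x = d\<close> by (simp add: tendsto_norm_zero_iff LIM_zero_iff)
qed

text \<open>Since both \<open>L r\<close> and \<open>L t\<close> are null,
  \<open>mink (L r - L t) (L r + L t) = 0\<close> holds exactly. Writing \<open>L r - L t\<close>
  through the slopes of \<open>\<beta>'\<close> and \<open>\<beta>\<close> gives an equation for the
  difference quotient of \<open>\<sigma>\<close>, whose limit needs only continuity of
  \<open>\<sigma>\<close>.\<close>

lemma observed_parameter_has_derivative:
  assumes obs: "observer \<beta> I" and obs': "observer \<beta>' I'" and t: "t \<in> I"
    and \<sigma>: "\<And>r. r \<in> I \<Longrightarrow> \<sigma> r \<in> I' \<and> \<beta>' (\<sigma> r) \<in> E_minus (\<beta> r)"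
  shows "(\<sigma> has_vector_derivative
      mink (four_velocity \<beta> I t) (\<beta>' (\<sigma> t) - \<beta> t) /
      mink (four_velocity \<beta>' I' (\<sigma> t)) (\<beta>' (\<sigma> t) - \<beta> t)) (at t within I)"
proof -
  let ?U = "four_velocity \<beta> I t" and ?U' = "four_velocity \<beta>' I' (\<sigma> t)"
  define L where "L r = \<beta>' (\<sigma> r) - \<beta> r" for r
  note d\<beta> = observer_has_vector_derivative(1)[OF obs t]
  have \<sigma>t: "\<sigma> t \<in> I'" using \<sigma> t by blast
  note d\<beta>' = observer_has_vector_derivative(1)[OF obs' \<sigma>t]
  have c\<beta>: "continuous (at t within I) \<beta>"
    using d\<beta> by (rule has_vector_derivative_continuous)
  have c\<sigma>: "continuous (at t within I) \<sigma>"
    using observed_parameter_continuous[OF obs' c\<beta> t] \<sigma> by blast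
  \<comment> \<open>Continuity within \<open>I'\<close> is enough, even if \<open>\<sigma> t\<close>
    is an endpoint, because \<open>\<sigma>\<close> maps \<open>I\<close> into
    \<open>I'\<close>.\<close>
  have comp: "continuous (at t within I) (\<lambda>r. g (\<sigma> r))"
    if "continuous (at (\<sigma> t) within I') g" for g :: "real \<Rightarrow> spacetime"
    using continuous_within_compose2[OF c\<sigma> continuous_within_subset[OF that]] \<sigma> by blast
  obtain B where B: "\<And>r. \<beta> r - \<beta> t = (r - t) *\<^sub>R B r" "continuous (at t within I) B" "B t = ?U"
    using has_vector_derivative_slope[OF d\<beta>] by metis
  obtain A where A: "\<And>r. \<beta>' r - \<beta>' (\<sigma> t) = (r - \<sigma> t) *\<^sub>R A r"
      "continuous (at (\<sigma> t) within I') A" "A (\<sigma> t) = ?U'"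
    using has_vector_derivative_slope[OF d\<beta>'] by metis
  have cL: "continuous (at t within I) L"
    unfolding L_def using comp[OF has_vector_derivative_continuous[OF d\<beta>']] c\<beta>
    by (rule continuous_diff)
  \<comment> \<open>The factors of the increments of \<open>\<sigma>\<close> and of the parameter in
    that identity. At \<open>t\<close> the sum \<open>L r + L t\<close> becomes
    \<open>2 *\<^sub>R L t\<close>, and the factor 2 cancels in \<open>Q t / P t\<close>.\<close>
  define P where "P r = mink (A (\<sigma> r)) (L r + L t)" for r
  define Q where "Q r = mink (B r) (L r + L t)" for r
  have null: "mink (L r) (L r) = 0" if "r \<in> I" for r
    using \<sigma>[OF that] by (simp add: E_minus_def lightlike_def L_def)
  have PQ: "(\<sigma> r - \<sigma> t) * P r = (r - t) * Q r" if "r \<in> I" for r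
  proof -
    have "0 = mink (L r - L t) (L r + L t)"
      using null[OF that] null[OF t] mink_commute[of "L r" "L t"] by (simp add: mink_linear_simps)
    also have "L r - L t = (\<sigma> r - \<sigma> t) *\<^sub>R A (\<sigma> r) - (r - t) *\<^sub>R B r"
      unfolding L_def A(1)[symmetric] B(1)[symmetric] by simp
    finally show ?thesis
      unfolding P_def Q_def by (simp only: mink_linear_simps) (simp add: algebra_simps)
  qed
  note bmt = bounded_bilinear.continuous[OF bounded_bilinear_mink]
  have cont: "continuous (at t within I) P" "continuous (at t within I) Q"
    unfolding P_def Q_def by (intro bmt comp[OF A(2)] B(2) continuous_add cL continuous_const)+
  have "L t + L t = 2 *\<^sub>R L t" by (simp add: scaleR_2)
  then have Pt: "P t = 2 * mink ?U' (L t)" and Qt: "Q t = 2 * mink ?U (L t)"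
    by (simp_all add: P_def Q_def A(3) B(3) mink_linear_simps)
  have pos: "0 < mink ?U' (L t)"
    using mink_future_past_pos observer_four_velocity(1,2)[OF obs' \<sigma>t] \<sigma>[OF t]
    by (simp add: E_minus_def L_def)
  then have P0: "P t \<noteq> 0" by (simp add: Pt)
  have "((\<lambda>r. Q r / P r) \<longlongrightarrow> Q t / P t) (at t within I)"
    using cont P0 unfolding continuous_within by (intro tendsto_divide)
  moreover have "\<forall>\<^sub>F r in at t within I. P r \<noteq> 0"
    using cont(1) P0 unfolding continuous_within by (rule tendsto_imp_eventually_ne)
  then have "\<forall>\<^sub>F r in at t within I. Q r / P r = (\<sigma> r - \<sigma> t) / (r - t)"
    unfolding eventually_at_filter
  proof eventually_elim
    case (elim r)
    show ?case
    proof (intro impI)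
      assume "r \<noteq> t" "r \<in> I"
      with elim PQ[of r] show "Q r / P r = (\<sigma> r - \<sigma> t) / (r - t)"
        by (simp add: frac_eq_eq mult.commute)
    qed
  qed
  ultimately have "((\<lambda>r. (\<sigma> r - \<sigma> t) / (r - t)) \<longlongrightarrow> Q t / P t) (at t within I)"
    by (rule Lim_transform_eventually)
  then have "(\<sigma> has_field_derivative Q t / P t) (at t within I)"
    by (simp add: has_field_derivative_iff)
  then show ?thesis
    by (simp add: has_real_derivative_iff_has_vector_derivative Pt Qt L_def)
qed

section \<open>The formula for the astrometric relative velocity\<close>

theorem proposition5p2:
  fixes \<beta> \<beta>' :: "real \<Rightarrow> spacetime" and I I' :: "real set" and t s :: real
  assumes "observer \<beta> I"
    and "observer \<beta>' I'"
    and "\<forall>p\<in>\<beta> ` I. \<exists>!q. q \<in> \<beta>' ` I' \<inter> E_minus p"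
    and "t \<in> I"
    and "s \<in> I'"
    and "\<beta>' s = observed_event \<beta>' I' (\<beta> t)"
  shows "V_ast \<beta> I \<beta>' I' t =
    (let U = four_velocity \<beta> I t;
         U' = four_velocity \<beta>' I' s;
         S = S_obs \<beta> I \<beta>' I' t
     in (1 / mink U' (S /\<^sub>R mink_norm S - U)) *\<^sub>R (U' + mink U' U *\<^sub>R U)
        + mink_norm S *\<^sub>R nabla_U I (four_velocity \<beta> I) t)"
proof -
  have ev: "observed_event \<beta>' I' (\<beta> r) \<in> \<beta>' ` I' \<inter> E_minus (\<beta> r)" if "r \<in> I" for r
    unfolding observed_event_def by (rule theI'[OF bspec[OF assms(3) imageI[OF that]]])
  then have "\<forall>r\<in>I. \<exists>x. x \<in> I' \<and> \<beta>' x = observed_event \<beta>' I' (\<beta> r)"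
    by (metis IntD1 imageE)
  then obtain \<sigma> where \<sigma>I: "\<And>r. r \<in> I \<Longrightarrow> \<sigma> r \<in> I'"
    and \<sigma>ev: "\<And>r. r \<in> I \<Longrightarrow> \<beta>' (\<sigma> r) = observed_event \<beta>' I' (\<beta> r)"
    by metis
  have \<sigma>E: "\<beta>' (\<sigma> r) \<in> E_minus (\<beta> r)" if "r \<in> I" for r
    using ev[OF that] \<sigma>ev[OF that] by simp
  \<comment> \<open>The parameter \<open>s\<close> is given only through its event, so the chosen
    \<open>\<sigma> t\<close> must be shown to agree with it; an observer meets a past light cone at
    no more than one parameter.\<close>
  have \<sigma>t: "\<sigma> t = s"
    using advanced_time_inj[OF assms(2) \<sigma>I[OF assms(4)] assms(5), of "\<beta> t"]
      \<sigma>E[OF assms(4)] \<sigma>ev[OF assms(4)] assms(6) by simp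
  define U where "U = four_velocity \<beta> I"
  define a where "a = nabla_U I U t"
  define U' where "U' = four_velocity \<beta>' I' s"
  define L where "L r = \<beta>' (\<sigma> r) - \<beta> r" for r
  define S where "S = S_obs \<beta> I \<beta>' I' t"
  define \<sigma>' where "\<sigma>' = mink (U t) (L t) / mink U' (L t)"
  have UU: "mink (U t) (U t) = -1"
    unfolding U_def using assms(1,4) by (rule observer_four_velocity)
  have aU: "mink a (U t) = 0"
    unfolding U_def a_def using assms(1,4) by (rule acceleration_orthogonal)
  have Lt: "lightlike (L t)" "past_pointing (L t)"
    using \<sigma>E[OF assms(4)] by (simp_all add: E_minus_def L_def)
  have pos: "0 < mink (U t) (L t)"
    using mink_future_past_pos observer_four_velocity(1,2)[OF assms(1,4)] Lt by (simp add: U_def)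
  have S_eq: "S = L t + mink (L t) (U t) *\<^sub>R U t"
    by (simp add: S_def S_obs_def proj_orth_def L_def U_def \<sigma>ev assms(4))
  have norm_S: "mink_norm S = mink (L t) (U t)"
    using mink_norm_proj_orth[of "L t" "U t"] UU Lt pos mink_commute[of "L t" "U t"]
    by (simp add: S_eq proj_orth_def lightlike_def)
  have d\<sigma>: "(\<sigma> has_vector_derivative \<sigma>') (at t within I)"
    using observed_parameter_has_derivative[OF assms(1,2,4), of \<sigma>] \<sigma>I \<sigma>E
    by (simp add: \<sigma>'_def U_def U'_def L_def \<sigma>t)
  \<comment> \<open>The chain rule asks for the derivative of \<open>\<beta>'\<close> within the
    image of \<open>\<sigma>\<close>, which may be smaller than \<open>I'\<close>.\<close>
  have "\<sigma> ` I \<subseteq> I'" using \<sigma>I by auto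
  then have "(\<beta>' has_vector_derivative U') (at (\<sigma> t) within \<sigma> ` I)"
    using observer_has_vector_derivative(1)[OF assms(2,5)] unfolding \<sigma>t U'_def
    by (blast intro: has_vector_derivative_within_subset)
  then have "((\<beta>' \<circ> \<sigma>) has_vector_derivative \<sigma>' *\<^sub>R U') (at t within I)"
    using d\<sigma> by (intro vector_diff_chain_within)
  then have dL: "(L has_vector_derivative \<sigma>' *\<^sub>R U' - U t) (at t within I)"
    unfolding L_def U_def using observer_has_vector_derivative(1)[OF assms(1,4)]
    by (intro has_vector_derivative_diff) (simp_all add: o_def)
  have dU: "(U has_vector_derivative a) (at t within I)"
    unfolding U_def a_def using assms(1,4) by (rule observer_has_vector_derivative)
  \<comment> \<open>The value of \<open>\<rho>\<close> is irrelevant: it multiplies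
    \<open>U t\<close>, which the projection annihilates.\<close>
  obtain \<rho> where d\<rho>: "((\<lambda>r. mink (L r) (U r)) has_vector_derivative \<rho>) (at t within I)"
    using bounded_bilinear.has_vector_derivative[OF bounded_bilinear_mink dL dU] by blast
  have "((\<lambda>r. L r + mink (L r) (U r) *\<^sub>R U r) has_vector_derivative
      (\<sigma>' *\<^sub>R U' - U t) + (mink (L t) (U t) *\<^sub>R a + \<rho> *\<^sub>R U t)) (at t within I)"
    by (intro has_vector_derivative_add dL
        bounded_bilinear.has_vector_derivative[OF bounded_bilinear_scaleR d\<rho> dU])
  then have "(S_obs \<beta> I \<beta>' I' has_vector_derivative
      (\<sigma>' *\<^sub>R U' - U t) + (mink (L t) (U t) *\<^sub>R a + \<rho> *\<^sub>R U t)) (at t within I)"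
    by (rule has_vector_derivative_transform[OF assms(4), rotated])
      (simp add: S_obs_def proj_orth_def L_def U_def \<sigma>ev)
  then have dS: "nabla_U I (S_obs \<beta> I \<beta>' I') t =
      (\<sigma>' *\<^sub>R U' - U t) + (mink (L t) (U t) *\<^sub>R a + \<rho> *\<^sub>R U t)"
    unfolding nabla_U_def
    by (rule vector_derivative_within[OF observer_at_within_nontrivial[OF assms(1,4)]])
  \<comment> \<open>The projection removes all multiples of \<open>U t\<close>, fixes
    \<open>a\<close>, which is orthogonal to \<open>U t\<close>, and leaves \<open>\<sigma>'\<close>
    times the projected \<open>U'\<close>.\<close>
  have V: "V_ast \<beta> I \<beta>' I' t = \<sigma>' *\<^sub>R (U' + mink U' (U t) *\<^sub>R U t) + mink_norm S *\<^sub>R a"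
    unfolding V_ast_def proj_orth_def norm_S dS U_def[symmetric]
    by (simp add: mink_linear_simps UU aU algebra_simps)
  have "mink (L t) (U t) \<noteq> 0"
    using pos by (simp add: mink_commute)
  then have "S /\<^sub>R mink_norm S - U t = L t /\<^sub>R mink (L t) (U t)"
    unfolding norm_S unfolding S_eq by (simp add: scaleR_add_right)
  then have "1 / mink U' (S /\<^sub>R mink_norm S - U t) = \<sigma>'"
    by (simp add: mink_linear_simps \<sigma>'_def mink_commute[of "L t" "U t"] divide_inverse)
  with V show ?thesis
    unfolding Let_def S_def U_def U'_def a_def by simp
qed

end
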